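(* Let $Y_1,Y_2,\dots$ be independent, identically distributed, nonnegative random variables with common distribution function $F_Y$ and density $f_Y$ with respect to Lebesgue measure. Let $S_n=Y_1+\cdots+Y_n$ and $M_n=\max\{Y_1,\dots,Y_n\}$, and let $(a_n)_{n\ge 1}$ be real numbers with $a_n\ge 0$, $a_n\to\infty$, such that $p^{(n)}=\mathbf{P}(S_n>a_n)\to 0$ and $\mathbf{P}(M_n>a_n)>0$ for every $n$. Suppose that $$\lim_{n\to\infty}\frac{\mathbf{P}(S_n>a_n)}{\mathbf{P}(M_n>a_n)}=1 .$$ For each $n$ let $(\mathbf{Y}^{(n)}_t)_{t\ge 0}$, $\mathbf{Y}^{(n)}_t=(Y_{t,1},\dots,Y_{t,n})$, be the Gibbs sampler Markov chain described in the context, started from its invariant distribution $F^{(n)}_{A_n}(\cdot)=\mathbf{P}((Y_1,\dots,Y_n)\in\cdot\mid S_n>a_n)$, and for a fixed integer $T\ge 1$ put $$\widehat q^{(n)}_T=\frac{1}{1-F_Y(a_n)^n}\cdot\frac1T\sum_{t=0}^{T-1} I\Big\{\max_{1\le j\le n}Y_{t,j}>a_n\Big\}.$$ Then $\widehat q^{(n)}_T$ has vanishing normalized variance for estimating $(p^{(n)})^{-1}$, that is, $$\lim_{n\to\infty}(p^{(n)})^2\,\mathrm{Var}_{F^{(n)}_{A_n}}\big(\widehat q^{(n)}_T\big)=0 .$$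
   Context: $I\{\cdot\}$ is the indicator function. $\mathrm{Var}_{F^{(n)}_{A_n}}$ denotes the variance when the Markov chain is stationary, i.e. $\mathbf{Y}^{(n)}_0\sim F^{(n)}_{A_n}$. Gibbs sampler. State space: vectors $\mathbf{y}\in A_n=\{\mathbf{y}\in\mathbb{R}^n: y_1+\dots+y_n>a_n\}$. Given the state $\mathbf{Y}_t^{(n)}$, the next state $\mathbf{Y}_{t+1}^{(n)}$ is produced as follows. (1) Draw a uniformly random ordering $j_1,\dots,j_n$ of $\{1,\dots,n\}$. (2) For $k=1,\dots,n$ successively: with $j=j_k$, replace the $j$th component of the current vector by a fresh sample from the conditional distribution of $Y$ given $Y+\sum_{i\ne j}y_i>a_n$, where $Y\sim F_Y$ is independent of everything else and $y_i$, $i\neq j$, are the current values of the other components (including those already updated). (3) Apply a uniformly random permutation, independent of everything else, to the components of the resulting vector. The result is $\mathbf{Y}_{t+1}^{(n)}$. The distribution $F^{(n)}_{A_n}$ is invariant for this chain. *)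

theory Defs
  imports "HOL-Probability.Probability" "HOL-Combinatorics.Multiset_Permutations"
begin

abbreviation Rn :: "nat \<Rightarrow> (nat \<Rightarrow> real) measure" where
  "Rn n \<equiv> PiM {1..n} (\<lambda>_. borel)"

text \<open>A time-homogeneous Markov chain on \<open>P\<close> with initial distribution \<open>init\<close> and transition
  kernel \<open>K\<close>. The \<open>\<sigma>\<close>-algebra conditioned on is the one generated by \<open>X 0, \<dots>, X t\<close>.\<close>

definition markov_chain ::
  "'b measure \<Rightarrow> 's measure \<Rightarrow> 's measure \<Rightarrow> ('s \<Rightarrow> 's measure) \<Rightarrow> (nat \<Rightarrow> 'b \<Rightarrow> 's) \<Rightarrow> bool" where
  "markov_chain P S init K X \<longleftrightarrow>
     prob_space P \<and>
     (\<forall>t. X t \<in> measurable P S) \<and>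
     distr P S (X 0) = init \<and>
     (\<forall>t. \<forall>B\<in>sets S. AE \<omega> in P.
        real_cond_exp P
          (vimage_algebra (space P) (\<lambda>\<omega>'. \<lambda>s\<in>{..t}. X s \<omega>') (PiM {..t} (\<lambda>_. S)))
          (\<lambda>\<omega>'. indicator B (X (Suc t) \<omega>')) \<omega>
        = measure (K (X t \<omega>)) B)"

text \<open>In the following, \<open>\<mu>\<close> is the law of a single \<open>Y\<close> and \<open>a\<close> is the threshold. The kernels are
  defined on all of \<open>\<real>\<^sup>n\<close>; every update produces a vector with \<open>y\<^sub>1 + \<dots> + y\<^sub>n > a\<close> almost surely,
  so a chain started in that set stays in it almost surely. (\<open>uniform_measure \<mu> B\<close> is \<open>\<mu>\<close>
  conditioned on \<open>B\<close>, which is meaningful when \<open>\<mu>\<close> gives \<open>B\<close> positive mass; this is the case for all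
  arguments as soon as \<open>\<mu>\<close> has unbounded support to the right.)\<close>

definition gibbs_update ::
  "real measure \<Rightarrow> nat \<Rightarrow> real \<Rightarrow> nat \<Rightarrow> (nat \<Rightarrow> real) \<Rightarrow> (nat \<Rightarrow> real) measure" where
  "gibbs_update \<mu> n a j y =
     do {
       x \<leftarrow> uniform_measure \<mu> {x. x + (\<Sum>i\<in>{1..n} - {j}. y i) > a};
       return (Rn n) (y(j := x))
     }"

primrec gibbs_sweep ::
  "real measure \<Rightarrow> nat \<Rightarrow> real \<Rightarrow> nat list \<Rightarrow> (nat \<Rightarrow> real) \<Rightarrow> (nat \<Rightarrow> real) measure" where
  "gibbs_sweep \<mu> n a [] y = return (Rn n) y"
| "gibbs_sweep \<mu> n a (j # js) y =
     do {
       z \<leftarrow> gibbs_update \<mu> n a j y;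
       gibbs_sweep \<mu> n a js z
     }"

definition gibbs_kernel ::
  "real measure \<Rightarrow> nat \<Rightarrow> real \<Rightarrow> (nat \<Rightarrow> real) \<Rightarrow> (nat \<Rightarrow> real) measure" where
  "gibbs_kernel \<mu> n a y =
     do {
       js \<leftarrow> uniform_count_measure (permutations_of_set {1..n});
       z \<leftarrow> gibbs_sweep \<mu> n a js y;
       \<pi> \<leftarrow> uniform_count_measure {\<pi>. \<pi> permutes {1..n}};
       return (Rn n) (\<lambda>i. z (\<pi> i))
     }"

definition cond_law ::
  "'a measure \<Rightarrow> (nat \<Rightarrow> 'a \<Rightarrow> real) \<Rightarrow> nat \<Rightarrow> real \<Rightarrow> (nat \<Rightarrow> real) measure" where
  "cond_law M Y n a =
     distr (uniform_measure M {\<omega>\<in>space M. (\<Sum>i=1..n. Y i \<omega>) > a}) (Rn n)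
       (\<lambda>\<omega>. \<lambda>i\<in>{1..n}. Y i \<omega>)"

definition q_hat ::
  "(real \<Rightarrow> real) \<Rightarrow> nat \<Rightarrow> real \<Rightarrow> nat \<Rightarrow> (nat \<Rightarrow> 'b \<Rightarrow> nat \<Rightarrow> real) \<Rightarrow> 'b \<Rightarrow> real" where
  "q_hat F n a T X \<omega> =
     1 / (1 - F a ^ n) * (1 / real T * (\<Sum>t<T. indicator {a<..} (MAX j\<in>{1..n}. X t \<omega> j)))"

end

theory Submission
  imports Defs
begin

text \<open>Each single-site update resamples one coordinate from its conditional law under the target, so
  it leaves the target invariant; so do the random scan, which is a mixture of compositions of
  updates, and the final permutation, by exchangeability. Hence the chain is stationary and each
  indicator in the estimator has mean \<open>r / p\<close>, where \<open>r = P(M\<^sub>n > a\<^sub>n) = 1 - F(a\<^sub>n)\<^sup>n\<close>; here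
  \<open>M\<^sub>n > a\<^sub>n\<close> implies \<open>S\<^sub>n > a\<^sub>n\<close> because the variables are nonnegative. No mixing is needed: the
  average \<open>A\<close> of the indicators lies in \<open>[0, 1]\<close>, so the variance of \<open>A / r\<close> is at most
  \<open>E (1 - A)\<^sup>2 / r\<^sup>2 \<le> (1 - r / p) / r\<^sup>2\<close>, and \<open>p\<^sup>2\<close> times this is \<open>(p / r)\<^sup>2 - p / r\<close>, which tends to
  \<open>0\<close>.\<close>

section \<open>Invariant distributions and stationary chains\<close>

lemma invariant_bind:
  assumes "f \<in> \<pi> \<rightarrow>\<^sub>M subprob_algebra N" "g \<in> N \<rightarrow>\<^sub>M subprob_algebra R"
    and "\<pi> \<bind> f = \<pi>" "\<pi> \<bind> g = \<pi>"
  shows "\<pi> \<bind> (\<lambda>y. f y \<bind> g) = \<pi>"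
  using bind_assoc[OF assms(1,2)] assms(3,4) by simp

text \<open>A finite index set carries the discrete sigma-algebra, so joint measurability in index
  and state reduces to measurability in the state for each fixed index.\<close>

lemma measurable_bind_uniform_count_measure:
  assumes "finite I" "I \<noteq> {}"
    and "\<And>i. i \<in> I \<Longrightarrow> K i \<in> N \<rightarrow>\<^sub>M prob_algebra R"
  shows "(\<lambda>y. uniform_count_measure I \<bind> (\<lambda>i. K i y)) \<in> N \<rightarrow>\<^sub>M prob_algebra R"
proof (rule measurable_bind_prob_space2)
  show "(\<lambda>_. uniform_count_measure I) \<in> N \<rightarrow>\<^sub>M prob_algebra (count_space I)"
    using assms(1,2) by (intro measurable_const)
      (simp add: space_prob_algebra prob_space_uniform_count_measure sets_uniform_count_measure)
  have "(\<lambda>(i, y). K i y) \<in> count_space I \<Otimes>\<^sub>M N \<rightarrow>\<^sub>M prob_algebra R"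
    using assms by (intro measurable_pair_measure_countable1) (auto simp: countable_finite)
  then show "(\<lambda>(y, i). K i y) \<in> N \<Otimes>\<^sub>M count_space I \<rightarrow>\<^sub>M prob_algebra R"
    using measurable_pair_swap by fastforce
qed

text \<open>The index is drawn independently of the state, so the two draws may be interchanged.
  With the index drawn first, each \<open>K i\<close> returns \<open>\<pi>\<close>, and averaging a
  constant family gives \<open>\<pi>\<close> back.\<close>

lemma invariant_mixture:
  assumes "prob_space \<pi>" "finite I" "I \<noteq> {}"
    and K: "\<And>i. i \<in> I \<Longrightarrow> K i \<in> \<pi> \<rightarrow>\<^sub>M prob_algebra R"
    and inv: "\<And>i. i \<in> I \<Longrightarrow> \<pi> \<bind> K i = \<pi>"
  shows "\<pi> \<bind> (\<lambda>y. uniform_count_measure I \<bind> (\<lambda>i. K i y)) = \<pi>"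
proof -
  let ?U = "uniform_count_measure I"
  interpret \<pi>: prob_space \<pi> by fact
  interpret U: prob_space ?U using assms by (intro prob_space_uniform_count_measure)
  interpret UP: pair_prob_space ?U \<pi> ..
  have "(\<lambda>(i, y). K i y) \<in> count_space I \<Otimes>\<^sub>M \<pi> \<rightarrow>\<^sub>M subprob_algebra R"
    using assms
    by (intro measurable_pair_measure_countable1) (auto simp: countable_finite intro: measurable_prob_algebraD)
  also have "count_space I \<Otimes>\<^sub>M \<pi> \<rightarrow>\<^sub>M subprob_algebra R = ?U \<Otimes>\<^sub>M \<pi> \<rightarrow>\<^sub>M subprob_algebra R"
    by (intro measurable_cong_sets sets_pair_measure_cong) (simp_all add: sets_uniform_count_measure)
  finally have "\<pi> \<bind> (\<lambda>y. ?U \<bind> (\<lambda>i. K i y)) = ?U \<bind> (\<lambda>i. \<pi> \<bind> K i)"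
    using UP.bind_rotate[of K R] by simp
  also have "\<dots> = ?U \<bind> (\<lambda>i. \<pi>)"
    using inv by (intro bind_cong) (auto simp: space_uniform_count_measure)
  also have "\<dots> = \<pi>"
  proof (rule measure_eqI)
    show "sets (?U \<bind> (\<lambda>i. \<pi>)) = sets \<pi>"
      using U.not_empty by (intro sets_bind) auto
  qed (rule emeasure_bind_const_prob_space, unfold_locales)
  finally show ?thesis .
qed

section \<open>Images of measures under coordinate maps\<close>

lemma measurable_permute_Rn:
  assumes "\<rho> permutes {1..n}"
  shows "(\<lambda>z i. z (\<rho> i)) \<in> Rn n \<rightarrow>\<^sub>M Rn n"
proof (rule measurable_PiM_single')
  \<comment> \<open>Vectors are \<open>undefined\<close> off \<open>{1..n}\<close>, and a
    permutation of \<open>{1..n}\<close> fixes all other indices, so the composition stays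
    extensional without an explicit restriction.\<close>
  show "(\<lambda>z i. z (\<rho> i)) \<in> space (Rn n) \<rightarrow> {1..n} \<rightarrow>\<^sub>E space borel"
    using assms by (auto simp: space_PiM PiE_iff extensional_def permutes_not_in)
  fix i assume "i \<in> {1..n}"
  then have "\<rho> i \<in> {1..n}" by (simp only: permutes_in_image[OF assms])
  then show "(\<lambda>z. z (\<rho> i)) \<in> borel_measurable (Rn n)"
    by (rule measurable_component_singleton)
qed

text \<open>Both sides assign to \<open>B\<close> the same quotient of masses of preimages. This
  later turns the conditional law of the sample into a conditioned product measure.\<close>

lemma distr_uniform_measure_vimage:
  assumes V: "V \<in> M \<rightarrow>\<^sub>M N" and A: "A \<in> sets N"
  shows "distr (uniform_measure M (V -` A \<inter> space M)) N V = uniform_measure (distr M N V) A"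
proof (rule measure_eqI)
  fix B assume "B \<in> sets (distr (uniform_measure M (V -` A \<inter> space M)) N V)"
  then have B: "B \<in> sets N" by simp
  have "emeasure (distr (uniform_measure M (V -` A \<inter> space M)) N V) B
      = emeasure (uniform_measure M (V -` A \<inter> space M)) (V -` B \<inter> space M)"
    using V B by (subst emeasure_distr) (simp_all cong: measurable_cong_sets)
  also have "\<dots> = emeasure M (V -` (A \<inter> B) \<inter> space M) / emeasure M (V -` A \<inter> space M)"
    using V A B by (subst emeasure_uniform_measure) (auto intro!: arg_cong2[where f = "(/)"] arg_cong2[where f = emeasure])
  also have "\<dots> = emeasure (uniform_measure (distr M N V) A) B"
    using V A B by (simp add: emeasure_distr)
  finally show "emeasure (distr (uniform_measure M (V -` A \<inter> space M)) N V) B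
      = emeasure (uniform_measure (distr M N V) A) B" .
qed simp

section \<open>One-time marginals of a stationary chain\<close>

text \<open>Integrating the Markov property over the past leaves the law of \<open>X t\<close>
  pushed through \<open>K\<close>; if the former is \<open>\<pi>\<close>, invariance makes the
  result \<open>\<pi>\<close> again.\<close>

lemma markov_chain_stationary:
  assumes X: "markov_chain P S \<pi> K X"
    and K: "K \<in> S \<rightarrow>\<^sub>M prob_algebra S" and inv: "\<pi> \<bind> K = \<pi>"
  shows "distr P S (X t) = \<pi>"
proof (induction t)
  case 0
  then show ?case using X by (simp add: markov_chain_def)
next
  case (Suc t)
  interpret P: prob_space P using X by (simp add: markov_chain_def)
  have X_meas[measurable]: "X s \<in> P \<rightarrow>\<^sub>M S" for s using X by (simp add: markov_chain_def)
  interpret \<pi>: prob_space \<pi> unfolding Suc[symmetric] by (intro P.prob_space_distr) simp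
  have sets_\<pi>: "sets \<pi> = sets S" unfolding Suc[symmetric] by simp
  have K': "K \<in> \<pi> \<rightarrow>\<^sub>M subprob_algebra S"
    using measurable_prob_algebraD[OF K] by (simp add: sets_\<pi> cong: measurable_cong_sets)
  let ?G = "vimage_algebra (space P) (\<lambda>\<omega>'. \<lambda>s\<in>{..t}. X s \<omega>') (PiM {..t} (\<lambda>_. S))"
  have "subalgebra P ?G"
    unfolding subalgebra_def
    using sets_image_in_sets[OF refl, of "\<lambda>\<omega>'. \<lambda>s\<in>{..t}. X s \<omega>'" P "PiM {..t} (\<lambda>_. S)"] by simp
  then interpret G: finite_measure_subalgebra P ?G
    by unfold_locales
  show ?case
  proof (rule measure_eqI)
    fix B assume "B \<in> sets (distr P S (X (Suc t)))"
    then have B[measurable]: "B \<in> sets S" by simp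
    interpret D: prob_space "distr P S (X (Suc t))"
      by (intro P.prob_space_distr) simp
    have int: "integrable P (\<lambda>\<omega>. indicator B (X (Suc t) \<omega>) :: real)"
      by (intro P.integrable_const_bound[of _ 1]) (auto simp: indicator_def)
    have "measure (distr P S (X (Suc t))) B = (\<integral>y. indicator B y \<partial>distr P S (X (Suc t)))"
      using B by simp
    also have "\<dots> = (\<integral>\<omega>. indicator B (X (Suc t) \<omega>) \<partial>P)"
      by (intro integral_distr) auto
    \<comment> \<open>A conditional expectation has the same mean as the variable itself, so
      conditioning on the whole past \<open>?G\<close> disappears after integration.\<close>
    also have "\<dots> = (\<integral>\<omega>. real_cond_exp P ?G (\<lambda>\<omega>'. indicator B (X (Suc t) \<omega>')) \<omega> \<partial>P)"
      using G.real_cond_exp_int(2)[OF int] by simp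
    also have "\<dots> = (\<integral>\<omega>. measure (K (X t \<omega>)) B \<partial>P)"
    proof (rule integral_cong_AE)
      show "AE \<omega> in P. real_cond_exp P ?G (\<lambda>\<omega>'. indicator B (X (Suc t) \<omega>')) \<omega> = measure (K (X t \<omega>)) B"
        using X B by (simp add: markov_chain_def)
      show "(\<lambda>\<omega>. measure (K (X t \<omega>)) B) \<in> borel_measurable P"
        using measurable_compose[OF measurable_compose[OF X_meas measurable_prob_algebraD[OF K]]
            measurable_measure_subprob_algebra[OF B]] .
    qed simp
    also have "\<dots> = (\<integral>y. measure (K y) B \<partial>distr P S (X t))"
      using measurable_compose[OF measurable_prob_algebraD[OF K] measurable_measure_subprob_algebra[OF B]]
      by (intro integral_distr[symmetric]) auto
    also have "\<dots> = measure (\<pi> \<bind> K) B"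
      unfolding Suc using K' B by (intro \<pi>.measure_bind[symmetric])
    finally have "measure (distr P S (X (Suc t))) B = measure \<pi> B"
      by (simp add: inv)
    then show "emeasure (distr P S (X (Suc t))) B = emeasure \<pi> B"
      by (simp add: D.emeasure_eq_measure \<pi>.emeasure_eq_measure)
  qed (simp add: sets_\<pi>)
qed

text \<open>The mean square deviation from \<open>c\<close> is the variance plus the squared bias
  \<open>(E Z - c)^2\<close>. A convenient \<open>c\<close> can thus replace the mean.\<close>

lemma (in prob_space) variance_le_mean_square_deviation:
  fixes Z :: "'a \<Rightarrow> real"
  assumes Z: "integrable M Z" "integrable M (\<lambda>x. (Z x)\<^sup>2)"
  shows "variance Z \<le> expectation (\<lambda>x. (Z x - c)\<^sup>2)"
proof -
  have "expectation (\<lambda>x. (Z x - c)\<^sup>2) = expectation (\<lambda>x. (Z x)\<^sup>2 - 2 * c * Z x + c\<^sup>2)"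
    by (simp add: power2_diff algebra_simps)
  also have "\<dots> = expectation (\<lambda>x. (Z x)\<^sup>2) - 2 * c * expectation Z + c\<^sup>2"
    using Z by (simp add: prob_space)
  also have "\<dots> = variance Z + (expectation Z - c)\<^sup>2"
    unfolding variance_eq[OF Z] by (simp add: power2_diff)
  finally show ?thesis by simp
qed

section \<open>Invariance of the Gibbs sampler\<close>

text \<open>The counterpart of \<open>cond_law\<close> on the product space, free of the underlying
  random variables; the two are identified in the final proof.\<close>

abbreviation gibbs_target :: "real measure \<Rightarrow> nat \<Rightarrow> real \<Rightarrow> (nat \<Rightarrow> real) measure" where
  "gibbs_target \<mu> n a \<equiv>
     uniform_measure (PiM {1..n} (\<lambda>_. \<mu>)) {y \<in> space (Rn n). (\<Sum>i=1..n. y i) > a}"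

text \<open>Positive mass beyond every level makes the conditioning event of an update non-null
  whatever the other coordinates are, so the update is a probability kernel on all of
  \<open>Rn n\<close>.\<close>

locale unbounded_law = real_distribution \<mu> for \<mu> :: "real measure" +
  assumes tail_pos: "emeasure \<mu> {c<..} > 0"
begin

lemma sets_PiM_law [measurable_cong, simp]: "sets (PiM I (\<lambda>_. \<mu>)) = sets (PiM I (\<lambda>_. borel))"
  by (intro sets_PiM_cong) auto

lemma space_PiM_law [simp]: "space (PiM I (\<lambda>_. \<mu>)) = space (PiM I (\<lambda>_. borel))"
  by (intro sets_eq_imp_space_eq) simp

lemma emeasure_sum_greater_pos:
  assumes "n \<ge> 1"
  shows "emeasure (PiM {1..n} (\<lambda>_. \<mu>)) {y \<in> space (Rn n). (\<Sum>i=1..n. y i) > a} > 0"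
proof -
  let ?N = "PiM {1..n} (\<lambda>_. \<mu>)" and ?A = "{y \<in> space (Rn n). (\<Sum>i=1..n. y i) > a}"
  interpret N: product_prob_space "\<lambda>_. \<mu>" "{1..n}" ..
  \<comment> \<open>A box of positive product mass inside the half-space. The level is
    \<open>\<bar>a\<bar>\<close> because for negative \<open>a\<close> the bound
    \<open>n * a \<ge> a\<close> may fail.\<close>
  have sub: "{y \<in> space ?N. \<forall>i\<in>{1..n}. y i \<in> {\<bar>a\<bar><..}} \<subseteq> ?A"
  proof safe
    fix y assume y: "y \<in> space ?N" "\<forall>i\<in>{1..n}. y i \<in> {\<bar>a\<bar><..}"
    then have "(\<Sum>i=1..n. y i) > (\<Sum>i=1..n. \<bar>a\<bar>)"
      using assms by (intro sum_strict_mono) auto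
    moreover have "(\<Sum>i=1..n. \<bar>a\<bar>) \<ge> \<bar>a\<bar>"
      using assms mult_right_mono[of 1 "real n" "\<bar>a\<bar>"] by simp
    ultimately show "a < (\<Sum>i=1..n. y i)" by linarith
  qed simp
  have "prob {\<bar>a\<bar><..} > 0"
    using tail_pos[of "\<bar>a\<bar>"] by (simp add: emeasure_eq_measure)
  then have "0 < (\<Prod>i\<in>{1..n}. emeasure \<mu> {\<bar>a\<bar><..})"
    by (simp add: emeasure_eq_measure ennreal_power)
  also have "\<dots> = emeasure ?N {y \<in> space ?N. \<forall>i\<in>{1..n}. y i \<in> {\<bar>a\<bar><..}}"
    by (rule N.emeasure_PiM_Collect[symmetric]) auto
  also have "\<dots> \<le> emeasure ?N ?A"
    by (rule emeasure_mono[OF sub]) measurable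
  finally show ?thesis .
qed

lemma prob_space_gibbs_target:
  assumes "n \<ge> 1"
  shows "prob_space (gibbs_target \<mu> n a)"
proof -
  interpret N: product_prob_space "\<lambda>_. \<mu>" "{1..n}" ..
  show ?thesis
    using emeasure_sum_greater_pos[OF assms] N.P.emeasure_finite
    by (intro prob_space_uniform_measure) (simp_all add: zero_less_iff_neq_zero del: One_nat_def)
qed

section \<open>The update of a single coordinate\<close>

lemma measurable_gibbs_update:
  assumes j: "j \<in> {1..n}"
  shows "gibbs_update \<mu> n a j \<in> Rn n \<rightarrow>\<^sub>M prob_algebra (Rn n)"
  unfolding gibbs_update_def
proof (rule measurable_bind_prob_space2)
  let ?S = "\<lambda>y. {x. x + (\<Sum>i\<in>{1..n} - {j}. y i) > a}"
  have S[simp]: "?S y \<in> sets \<mu>" for y by simp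
  have ne: "emeasure \<mu> (?S y) \<noteq> 0" for y
    using tail_pos[of "a - (\<Sum>i\<in>{1..n} - {j}. y i)"]
    by (simp add: greaterThan_def diff_less_eq)
  show "(\<lambda>y. uniform_measure \<mu> (?S y)) \<in> Rn n \<rightarrow>\<^sub>M prob_algebra borel"
  proof (intro measurable_prob_algebraI measurable_subprob_algebra)
    show P: "prob_space (uniform_measure \<mu> (?S y))" for y
      using ne by (intro prob_space_uniform_measure) auto
    show "subprob_space (uniform_measure \<mu> (?S y))" for y
      using P prob_space_imp_subprob_space by blast
    fix B :: "real set" assume B[measurable]: "B \<in> sets borel"
    \<comment> \<open>\<open>C = B\<close> gives the numerator and \<open>C = UNIV\<close> the
      normalising constant; both depend on \<open>y\<close> and are measures of sections of a
      measurable set.\<close>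
    have *: "(\<lambda>y. emeasure \<mu> {x \<in> space \<mu>. x + (\<Sum>i\<in>{1..n} - {j}. y i) > a \<and> x \<in> C}) \<in> borel_measurable (Rn n)"
      if [measurable]: "C \<in> sets borel" for C
      by measurable
    from *[OF B] *[of UNIV]
    have "(\<lambda>y. emeasure \<mu> (?S y \<inter> B) / emeasure \<mu> (?S y)) \<in> borel_measurable (Rn n)"
      by (simp add: Int_def)
    then show "(\<lambda>y. emeasure (uniform_measure \<mu> (?S y)) B) \<in> borel_measurable (Rn n)"
      using B by simp
  qed simp
  have "(\<lambda>(y, x). y(j := x)) \<in> Rn n \<Otimes>\<^sub>M borel \<rightarrow>\<^sub>M Rn n"
    using measurable_add_dim[of j "{1..n}" "\<lambda>_. borel"] by (simp only: insert_absorb[OF j])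
  then show "(\<lambda>(y, x). return (Rn n) (y(j := x))) \<in> Rn n \<Otimes>\<^sub>M borel \<rightarrow>\<^sub>M prob_algebra (Rn n)"
    unfolding case_prod_beta by measurable
qed

text \<open>Unfolds the monadic update into an integral against \<open>\<mu>\<close> with an
  explicit normalising constant, the form in which that constant can be cancelled.\<close>

lemma nn_integral_gibbs_update:
  assumes j: "j \<in> {1..n}" and y: "y \<in> space (Rn n)" and f[measurable]: "f \<in> borel_measurable (Rn n)"
  shows "(\<integral>\<^sup>+z. f z \<partial>gibbs_update \<mu> n a j y) =
    (\<integral>\<^sup>+x. f (y(j := x)) * indicator {x. x + (\<Sum>i\<in>{1..n} - {j}. y i) > a} x \<partial>\<mu>)
      / emeasure \<mu> {x. x + (\<Sum>i\<in>{1..n} - {j}. y i) > a}"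
proof -
  have [measurable]: "(\<lambda>x. y(j := x)) \<in> borel \<rightarrow>\<^sub>M Rn n"
    using measurable_Pair_compose_split[OF measurable_add_dim[of j "{1..n}" "\<lambda>_. borel"]
        measurable_const[OF y] measurable_ident[of borel]]
    by (simp only: insert_absorb[OF j] id_apply)
  let ?S = "{x. x + (\<Sum>i\<in>{1..n} - {j}. y i) > a}"
  have "gibbs_update \<mu> n a j y = distr (uniform_measure \<mu> ?S) (Rn n) (\<lambda>x. y(j := x))"
    unfolding gibbs_update_def
    by (intro bind_return_distr') (auto cong: measurable_cong_sets simp del: One_nat_def)
  also have "integral\<^sup>N \<dots> f = (\<integral>\<^sup>+x. f (y(j := x)) \<partial>uniform_measure \<mu> ?S)"
    by (intro nn_integral_distr) (simp_all cong: measurable_cong_sets del: One_nat_def)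
  also have "\<dots> = (\<integral>\<^sup>+x. f (y(j := x)) * indicator ?S x \<partial>\<mu>) / emeasure \<mu> ?S"
    by (intro nn_integral_uniform_measure) (simp_all cong: measurable_cong_sets)
  finally show ?thesis .
qed

text \<open>Integrating out the \<open>j\<close>-th coordinate of the target produces exactly the normalising constant
  that the conditional distribution in the update divides by.\<close>

lemma gibbs_update_invariant:
  assumes j: "j \<in> {1..n}"
  shows "gibbs_target \<mu> n a \<bind> gibbs_update \<mu> n a j = gibbs_target \<mu> n a"
proof (rule measure_eqI)
  let ?N = "PiM {1..n} (\<lambda>_. \<mu>)" and ?A = "{y \<in> space (Rn n). (\<Sum>i=1..n. y i) > a}"
  let ?I = "{1..n} - {j}"
  let ?S = "\<lambda>y. {x. x + (\<Sum>i\<in>?I. y i) > a}"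
  let ?U = "gibbs_update \<mu> n a j"
  interpret N: product_sigma_finite "\<lambda>_. \<mu>" ..
  have ins: "insert j ?I = {1..n}" using j by blast
  have U[measurable]: "?U \<in> Rn n \<rightarrow>\<^sub>M subprob_algebra (Rn n)"
    using measurable_gibbs_update[OF j] by (rule measurable_prob_algebraD)
  have ne: "space (Rn n) \<noteq> {}" by (simp add: space_PiM PiE_eq_empty_iff)
  have U': "?U \<in> gibbs_target \<mu> n a \<rightarrow>\<^sub>M subprob_algebra (Rn n)"
    using U by (simp cong: measurable_cong_sets)
  show sets: "sets (gibbs_target \<mu> n a \<bind> ?U) = sets (gibbs_target \<mu> n a)"
    using ne sets_kernel[OF U] by (subst sets_bind[where N = "Rn n"]) (simp_all del: One_nat_def)
  fix B assume "B \<in> sets (gibbs_target \<mu> n a \<bind> ?U)"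
  then have B[measurable]: "B \<in> sets (Rn n)" by (simp only: sets) (simp only: sets_uniform_measure sets_PiM_law)
  have upd: "w(j := x) \<in> space (Rn n)" if "w \<in> space (PiM ?I (\<lambda>_. borel))" for w :: "nat \<Rightarrow> real" and x
    using that ins by (auto simp: space_PiM PiE_iff extensional_def)
  have updA: "w(j := x) \<in> ?A \<longleftrightarrow> x \<in> ?S w" if "w \<in> space (PiM ?I (\<lambda>_. borel))" for w x
  proof -
    have "(\<Sum>i=1..n. (w(j := x)) i) = x + (\<Sum>i\<in>?I. w i)"
      using j by (subst sum.remove[of _ j]) auto
    then show ?thesis using upd[OF that] by simp
  qed
  \<comment> \<open>Splits coordinate \<open>j\<close> off from the remaining coordinates
    \<open>w\<close>.\<close>
  have fubini: "(\<integral>\<^sup>+y. g y \<partial>?N) = (\<integral>\<^sup>+w. \<integral>\<^sup>+x. g (w(j := x)) \<partial>\<mu> \<partial>PiM ?I (\<lambda>_. \<mu>))"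
    if "g \<in> borel_measurable (Rn n)" for g
  proof -
    have "g \<in> borel_measurable (PiM (insert j ?I) (\<lambda>_. \<mu>))"
      using that unfolding ins by (simp cong: measurable_cong_sets)
    then show ?thesis
      using N.product_nn_integral_insert[of ?I j g] by (simp only: ins) simp
  qed
  have "(\<integral>\<^sup>+y. emeasure (?U y) B * indicator ?A y \<partial>?N)
      = (\<integral>\<^sup>+w. \<integral>\<^sup>+x. emeasure (?U (w(j := x))) B * indicator ?A (w(j := x)) \<partial>\<mu> \<partial>PiM ?I (\<lambda>_. \<mu>))"
    by (intro fubini) measurable
  \<comment> \<open>It suffices to compare the inner integrals for each fixed
    \<open>w\<close>.\<close>
  also have "\<dots> = (\<integral>\<^sup>+w. \<integral>\<^sup>+x. indicator B (w(j := x)) * indicator ?A (w(j := x)) \<partial>\<mu> \<partial>PiM ?I (\<lambda>_. \<mu>))"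
  proof (rule nn_integral_cong)
    fix w assume "w \<in> space (PiM ?I (\<lambda>_. \<mu>))"
    then have w: "w \<in> space (PiM ?I (\<lambda>_. borel))" by simp
    define m where "m = emeasure \<mu> (?S w)"
    define c where "c = (\<integral>\<^sup>+x. indicator B (w(j := x)) * indicator ?A (w(j := x)) \<partial>\<mu>)"
    \<comment> \<open>Both facts are required for the cancellation \<open>c / m * m = c\<close> in
      the extended reals.\<close>
    have m: "m \<noteq> 0" "m \<noteq> \<top>"
      using tail_pos[of "a - (\<Sum>i\<in>?I. w i)"]
      by (simp_all add: m_def greaterThan_def diff_less_eq)
    \<comment> \<open>The update overwrites coordinate \<open>j\<close>, so its law does not depend
      on the old value \<open>x\<close>.\<close>
    have "emeasure (?U (w(j := x))) B = c / m" for x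
    proof -
      have "emeasure (?U (w(j := x))) B = (\<integral>\<^sup>+z. indicator B z \<partial>?U (w(j := x)))"
        using B sets_kernel[OF U upd[OF w]] by simp
      also have "\<dots> = (\<integral>\<^sup>+x'. indicator B (w(j := x')) * indicator (?S w) x' \<partial>\<mu>) / m"
        using upd[OF w] j by (subst nn_integral_gibbs_update) (auto simp: m_def simp del: One_nat_def)
      also have "(\<integral>\<^sup>+x'. indicator B (w(j := x')) * indicator (?S w) x' \<partial>\<mu>) = c"
        unfolding c_def using updA[OF w] by (intro nn_integral_cong) (auto simp: indicator_def)
      finally show ?thesis .
    qed
    then have "(\<integral>\<^sup>+x. emeasure (?U (w(j := x))) B * indicator ?A (w(j := x)) \<partial>\<mu>)
        = (\<integral>\<^sup>+x. c / m * indicator (?S w) x \<partial>\<mu>)"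
      using updA[OF w] by (intro nn_integral_cong) (auto simp: indicator_def)
    also have "\<dots> = c / m * m"
      by (subst nn_integral_cmult_indicator) (auto simp: m_def)
    also have "\<dots> = c"
      using m by (simp add: ennreal_divide_times ennreal_divide_self top.not_eq_extremum)
    finally show "(\<integral>\<^sup>+x. emeasure (?U (w(j := x))) B * indicator ?A (w(j := x)) \<partial>\<mu>) = c" .
  qed
  also have "\<dots> = (\<integral>\<^sup>+y. indicator B y * indicator ?A y \<partial>?N)"
    by (intro fubini[symmetric]) measurable
  also have "\<dots> = emeasure ?N (?A \<inter> B)"
    by (simp flip: indicator_inter_arith add: Int_commute del: One_nat_def)
  finally have *: "(\<integral>\<^sup>+y. emeasure (?U y) B * indicator ?A y \<partial>?N) = emeasure ?N (?A \<inter> B)" .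
  have "emeasure (gibbs_target \<mu> n a \<bind> ?U) B = (\<integral>\<^sup>+y. emeasure (?U y) B \<partial>gibbs_target \<mu> n a)"
    using ne by (intro emeasure_bind[OF _ U' B]) simp
  also have "\<dots> = (\<integral>\<^sup>+y. emeasure (?U y) B * indicator ?A y \<partial>?N) / emeasure ?N ?A"
    by (intro nn_integral_uniform_measure) measurable
  also have "\<dots> = emeasure (gibbs_target \<mu> n a) B"
    by (simp add: * del: One_nat_def)
  finally show "emeasure (gibbs_target \<mu> n a \<bind> ?U) B = emeasure (gibbs_target \<mu> n a) B" .
qed

section \<open>Sweeps, the final permutation and the full kernel\<close>

lemma measurable_gibbs_sweep:
  assumes "set js \<subseteq> {1..n}"
  shows "gibbs_sweep \<mu> n a js \<in> Rn n \<rightarrow>\<^sub>M prob_algebra (Rn n)"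
  using assms
proof (induction js)
  case (Cons j js)
  then show ?case
    unfolding gibbs_sweep.simps
    by (intro measurable_bind_prob_space[OF measurable_gibbs_update]) auto
qed (simp add: gibbs_sweep.simps(1)[abs_def])

text \<open>Stated for arbitrary lists of coordinates because the induction passes to tails, and a
  proper tail of a scan order is no longer an ordering of \<open>{1..n}\<close>.\<close>

lemma gibbs_sweep_invariant:
  assumes "set js \<subseteq> {1..n}"
  shows "gibbs_target \<mu> n a \<bind> gibbs_sweep \<mu> n a js = gibbs_target \<mu> n a"
  using assms
proof (induction js)
  case Nil
  \<comment> \<open>\<open>return\<close> depends on its measure argument only through the
    sigma-algebra.\<close>
  have "return (Rn n) = return (gibbs_target \<mu> n a)"
    by (intro ext return_cong) simp
  then show ?case by (simp add: gibbs_sweep.simps(1)[abs_def] bind_return')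
next
  case (Cons j js)
  then show ?case
    unfolding gibbs_sweep.simps
    by (intro invariant_bind[where N = "Rn n" and R = "Rn n"] gibbs_update_invariant)
       (auto intro!: measurable_prob_algebraD measurable_gibbs_update measurable_gibbs_sweep
         simp del: One_nat_def cong: measurable_cong_sets)
qed

text \<open>The product of identical factors is unchanged by reindexing, and the conditioning event
  depends only on the sum, which is symmetric.\<close>

lemma gibbs_target_exchangeable:
  assumes \<rho>: "\<rho> permutes {1..n}"
  shows "distr (gibbs_target \<mu> n a) (Rn n) (\<lambda>z i. z (\<rho> i)) = gibbs_target \<mu> n a"
proof (rule measure_eqI)
  let ?N = "PiM {1..n} (\<lambda>_. \<mu>)" and ?A = "{y \<in> space (Rn n). (\<Sum>i=1..n. y i) > a}"
  let ?r = "\<lambda>z i. z (\<rho> i) :: real"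
  note r[measurable] = measurable_permute_Rn[OF \<rho>]
  have "distr ?N (Rn n) ?r = distr ?N ?N (\<lambda>z. \<lambda>i\<in>{1..n}. z (\<rho> i))"
  proof (rule distr_cong)
    fix z assume "z \<in> space ?N"
    then show "?r z = (\<lambda>i\<in>{1..n}. z (\<rho> i))"
      using \<rho> by (auto simp: space_PiM PiE_iff extensional_def fun_eq_iff permutes_not_in)
  qed auto
  also have "\<dots> = ?N"
    using permutes_inj_on[OF \<rho>] permutes_in_image[OF \<rho>] prob_space_axioms
    by (intro distr_PiM_reindex) blast+
  finally have N: "distr ?N (Rn n) ?r = ?N" .
  have sum: "(\<Sum>i=1..n. z (\<rho> i)) = (\<Sum>i=1..n. z i)" for z :: "nat \<Rightarrow> real"
    using sum.permute[OF \<rho>, of z] by (simp add: comp_def)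
  show "sets (distr (gibbs_target \<mu> n a) (Rn n) ?r) = sets (gibbs_target \<mu> n a)" by simp
  fix B assume "B \<in> sets (distr (gibbs_target \<mu> n a) (Rn n) ?r)"
  then have B[measurable]: "B \<in> sets (Rn n)" by simp
  have "emeasure ?N (?A \<inter> B) = emeasure (distr ?N (Rn n) ?r) (?A \<inter> B)"
    by (simp only: N)
  also have "\<dots> = emeasure ?N (?r -` (?A \<inter> B) \<inter> space ?N)"
    by (intro emeasure_distr) (simp_all cong: measurable_cong_sets del: One_nat_def)
  also have "?r -` (?A \<inter> B) \<inter> space ?N = ?A \<inter> (?r -` B \<inter> space (Rn n))"
    using measurable_space[OF r] by (simp only: set_eq_iff vimage_eq Int_iff mem_Collect_eq sum space_PiM_law) blast
  finally have eq: "emeasure ?N (?A \<inter> B) = emeasure ?N (?A \<inter> (?r -` B \<inter> space (Rn n)))" .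
  have "emeasure (distr (gibbs_target \<mu> n a) (Rn n) ?r) B = emeasure (gibbs_target \<mu> n a) (?r -` B \<inter> space (Rn n))"
    by (subst emeasure_distr) (simp_all cong: measurable_cong_sets del: One_nat_def)
  also have "\<dots> = emeasure (gibbs_target \<mu> n a) B"
    by (simp add: eq del: One_nat_def)
  finally show "emeasure (distr (gibbs_target \<mu> n a) (Rn n) ?r) B = emeasure (gibbs_target \<mu> n a) B" .
qed

text \<open>The permutation is drawn independently of the scan order and so splits off as a kernel
  \<open>R\<close>, itself a mixture over permutations. The full kernel is a mixture over scan
  orders of a sweep followed by \<open>R\<close>, and every layer preserves the target.\<close>

lemma gibbs_kernel_measurable_invariant:
  assumes n: "n \<ge> 1"
  shows "gibbs_kernel \<mu> n a \<in> Rn n \<rightarrow>\<^sub>M prob_algebra (Rn n)"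
    and "gibbs_target \<mu> n a \<bind> gibbs_kernel \<mu> n a = gibbs_target \<mu> n a"
proof -
  let ?\<pi> = "gibbs_target \<mu> n a"
  define R where "R = (\<lambda>z. uniform_count_measure {\<pi>. \<pi> permutes {1..n}} \<bind> (\<lambda>\<pi>. return (Rn n) (\<lambda>i. z (\<pi> i))))"
  have perm: "finite {\<pi>. \<pi> permutes {1..n}}" "{\<pi>. \<pi> permutes {1..n}} \<noteq> {}"
    using permutes_id[of "{1..n}"] by (blast intro: finite_permutations finite_atLeastAtMost)+
  have js: "finite (permutations_of_set {1..n})" "permutations_of_set {1..n} \<noteq> {}"
    by auto
  have M: "measurable ?\<pi> = measurable (Rn n)"
    by (intro ext measurable_cong_sets) auto
  have ret: "(\<lambda>z. return (Rn n) (\<lambda>i. z (\<rho> i))) \<in> Rn n \<rightarrow>\<^sub>M prob_algebra (Rn n)"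
    if "\<rho> permutes {1..n}" for \<rho>
    using measurable_compose[OF measurable_permute_Rn[OF that] measurable_return_prob_space] .
  have R: "R \<in> Rn n \<rightarrow>\<^sub>M prob_algebra (Rn n)"
    unfolding R_def using perm ret by (intro measurable_bind_uniform_count_measure) auto
  have R_inv: "?\<pi> \<bind> R = ?\<pi>"
    unfolding R_def
  proof (intro invariant_mixture prob_space_gibbs_target n perm)
    fix \<rho> assume "\<rho> \<in> {\<pi>. \<pi> permutes {1..n}}"
    then have \<rho>: "\<rho> permutes {1..n}" by simp
    show "(\<lambda>z. return (Rn n) (\<lambda>i. z (\<rho> i))) \<in> ?\<pi> \<rightarrow>\<^sub>M prob_algebra (Rn n)"
      using ret[OF \<rho>] by (simp add: M)
    have "?\<pi> \<bind> (\<lambda>z. return (Rn n) (\<lambda>i. z (\<rho> i))) = distr ?\<pi> (Rn n) (\<lambda>z i. z (\<rho> i))"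
      using measurable_permute_Rn[OF \<rho>]
      by (intro bind_return_distr') (auto simp: M space_PiM PiE_eq_empty_iff)
    then show "?\<pi> \<bind> (\<lambda>z. return (Rn n) (\<lambda>i. z (\<rho> i))) = ?\<pi>"
      by (simp only: gibbs_target_exchangeable[OF \<rho>])
  qed
  have K: "gibbs_kernel \<mu> n a =
      (\<lambda>y. uniform_count_measure (permutations_of_set {1..n}) \<bind> (\<lambda>js. gibbs_sweep \<mu> n a js y \<bind> R))"
    by (simp add: gibbs_kernel_def R_def fun_eq_iff)
  have sw: "gibbs_sweep \<mu> n a js \<in> Rn n \<rightarrow>\<^sub>M prob_algebra (Rn n)"
    "?\<pi> \<bind> gibbs_sweep \<mu> n a js = ?\<pi>" if "js \<in> permutations_of_set {1..n}" for js
    using that measurable_gibbs_sweep gibbs_sweep_invariant by (auto simp: permutations_of_set_def)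
  have swR: "(\<lambda>y. gibbs_sweep \<mu> n a js y \<bind> R) \<in> Rn n \<rightarrow>\<^sub>M prob_algebra (Rn n)"
    if "js \<in> permutations_of_set {1..n}" for js
    using measurable_bind_prob_space[OF sw(1)[OF that] R] .
  show "gibbs_kernel \<mu> n a \<in> Rn n \<rightarrow>\<^sub>M prob_algebra (Rn n)"
    unfolding K using js swR by (intro measurable_bind_uniform_count_measure) auto
  show "?\<pi> \<bind> gibbs_kernel \<mu> n a = ?\<pi>"
    unfolding K
  proof (intro invariant_mixture prob_space_gibbs_target n js)
    fix js assume js: "js \<in> permutations_of_set {1..n}"
    show "(\<lambda>y. gibbs_sweep \<mu> n a js y \<bind> R) \<in> ?\<pi> \<rightarrow>\<^sub>M prob_algebra (Rn n)"
      using swR[OF js] by (simp add: M)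
    show "?\<pi> \<bind> (\<lambda>y. gibbs_sweep \<mu> n a js y \<bind> R) = ?\<pi>"
      using sw[OF js] R R_inv
      by (intro invariant_bind) (auto intro: measurable_prob_algebraD simp: M)
  qed
qed

end

section \<open>The variance of the estimator\<close>

context unbounded_law
begin


text \<open>The complement says that all coordinates are at most \<open>a\<close>, an event of
  product form.\<close>

lemma measure_Max_greater:
  assumes "n \<ge> 1"
  shows "measure (PiM {1..n} (\<lambda>_. \<mu>)) {y \<in> space (Rn n). (MAX j\<in>{1..n}. y j) > a} = 1 - cdf \<mu> a ^ n"
proof -
  let ?N = "PiM {1..n} (\<lambda>_. \<mu>)"
  let ?C = "{y \<in> space ?N. \<forall>j\<in>{1..n}. y j \<in> {..a}}"
  interpret N: product_prob_space "\<lambda>_. \<mu>" "{1..n}" ..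
  have C: "?C \<in> sets ?N" by measurable
  have "emeasure ?N ?C = (\<Prod>j\<in>{1..n}. emeasure \<mu> {..a})"
    by (intro N.emeasure_PiM_Collect) auto
  then have C_eq: "measure ?N ?C = cdf \<mu> a ^ n"
    by (simp add: cdf_def emeasure_eq_measure measure_def[of ?N] ennreal_power del: One_nat_def)
  have "{y \<in> space (Rn n). (MAX j\<in>{1..n}. y j) > a} = space ?N - ?C"
    using assms by (auto simp: Max_gr_iff not_le)
  then show ?thesis
    using N.P.prob_compl[OF C] C_eq by simp
qed

lemma cdf_power_less_1:
  assumes "n \<ge> 1"
  shows "cdf \<mu> a ^ n < 1"
proof -
  have "cdf \<mu> a = 1 - prob {a<..}"
    using prob_compl[of "{a<..}"] space_eq_univ by (simp add: cdf_def Compl_eq_Diff_UNIV[symmetric])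
  moreover have "prob {a<..} > 0"
    using tail_pos[of a] by (simp add: emeasure_eq_measure)
  moreover have "cdf \<mu> a \<ge> 0" by (simp add: cdf_def)
  ultimately show ?thesis
    using assms by (intro power_less_one_iff[THEN iffD2]) auto
qed

lemma gibbs_target_Max_greater:
  assumes n: "n \<ge> 1" and nonneg: "AE x in \<mu>. x \<ge> 0"
  shows "measure (gibbs_target \<mu> n a) {y \<in> space (Rn n). (MAX j\<in>{1..n}. y j) > a}
    = (1 - cdf \<mu> a ^ n) / measure (PiM {1..n} (\<lambda>_. \<mu>)) {y \<in> space (Rn n). (\<Sum>i=1..n. y i) > a}"
proof -
  let ?N = "PiM {1..n} (\<lambda>_. \<mu>)" and ?A = "{y \<in> space (Rn n). (\<Sum>i=1..n. y i) > a}"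
  let ?H = "{y \<in> space (Rn n). (MAX j\<in>{1..n}. y j) > a}"
  interpret N: product_prob_space "\<lambda>_. \<mu>" "{1..n}" ..
  have A[measurable]: "?A \<in> sets ?N" and H[measurable]: "?H \<in> sets ?N"
    by (simp_all del: One_nat_def) measurable
  have "AE y in ?N. \<forall>i\<in>{1..n}. y i \<ge> 0"
    using nonneg prob_space_axioms by (intro AE_finite_allI AE_PiM_component) auto
  \<comment> \<open>A nonnegative vector has a sum at least as large as each coordinate.
    Nonnegativity holds only almost everywhere, hence so does this inclusion of \<open>?H\<close> in
    \<open>?A\<close>.\<close>
  then have "AE y in ?N. y \<in> ?A \<inter> ?H \<longleftrightarrow> y \<in> ?H"
  proof eventually_elim
    case (elim y)
    have "(\<Sum>i=1..n. y i) > a" if max: "(MAX j\<in>{1..n}. y j) > a"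
    proof -
      obtain j where j: "j \<in> {1..n}" "y j > a"
        using max n by (auto simp: Max_gr_iff)
      have "y j \<le> (\<Sum>i=1..n. y i)"
        using elim j by (intro member_le_sum) auto
      then show ?thesis using j by linarith
    qed
    then show ?case by auto
  qed
  then have "measure ?N (?A \<inter> ?H) = measure ?N ?H"
    by (intro N.P.finite_measure_eq_AE) auto
  then show ?thesis
    using measure_Max_greater[OF n, of a] emeasure_sum_greater_pos[OF n, of a] N.P.emeasure_finite A H
    by (subst measure_uniform_measure) (simp_all add: zero_less_iff_neq_zero del: One_nat_def)
qed

text \<open>Only the one-time marginals enter, through the mean of \<open>avg\<close>; the
  dependence between successive states is absorbed by \<open>0 \<le> avg \<le> 1\<close>. The bound
  is therefore uniform in \<open>T\<close>.\<close>

lemma q_hat_variance_bound: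
  assumes n: "n \<ge> 1" and T: "T \<ge> 1" and nonneg: "AE x in \<mu>. x \<ge> 0"
    and X: "markov_chain P (Rn n) (gibbs_target \<mu> n a) (gibbs_kernel \<mu> n a) X"
  defines "p \<equiv> measure (PiM {1..n} (\<lambda>_. \<mu>)) {y \<in> space (Rn n). (\<Sum>i=1..n. y i) > a}"
    and "r \<equiv> 1 - cdf \<mu> a ^ n"
  shows "p\<^sup>2 * prob_space.variance P (q_hat (cdf \<mu>) n a T X) \<le> (p / r)\<^sup>2 - p / r"
proof -
  let ?H = "{y \<in> space (Rn n). (MAX j\<in>{1..n}. y j) > a}"
  interpret P: prob_space P using X by (simp add: markov_chain_def)
  interpret N: product_prob_space "\<lambda>_. \<mu>" "{1..n}" ..
  have X_meas[measurable]: "X t \<in> P \<rightarrow>\<^sub>M Rn n" for t using X by (simp add: markov_chain_def)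
  have H: "?H \<in> sets (Rn n)" by measurable
  have r: "r > 0" using cdf_power_less_1[OF n, of a] by (simp add: r_def)
  define J where "J t \<omega> = (indicator ?H (X t \<omega>) :: real)" for t \<omega>
  have J_meas[measurable]: "J t \<in> borel_measurable P" for t
    unfolding J_def using H by measurable
  have J01: "0 \<le> J t \<omega>" "J t \<omega> \<le> 1" for t \<omega> by (auto simp: J_def indicator_def)
  define avg where "avg \<omega> = (\<Sum>t<T. J t \<omega>) / T" for \<omega>
  have avg_meas[measurable]: "avg \<in> borel_measurable P" unfolding avg_def by measurable
  have avg01: "0 \<le> avg \<omega>" "avg \<omega> \<le> 1" for \<omega>
    using T J01 sum_bounded_above[of "{..<T}" "\<lambda>t. J t \<omega>" 1]
    by (auto simp: avg_def sum_nonneg divide_le_eq)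
  \<comment> \<open>The equality is restricted to \<open>space P\<close> because \<open>?H\<close>
    also demands membership in \<open>space (Rn n)\<close>.\<close>
  have q: "q_hat (cdf \<mu>) n a T X \<omega> = avg \<omega> / r" if "\<omega> \<in> space P" for \<omega>
    using measurable_space[OF X_meas that]
    by (simp add: q_hat_def avg_def J_def r_def indicator_def del: One_nat_def)
  have EJ: "P.expectation (J t) = r / p" for t
  proof -
    have "P.expectation (J t) = (\<integral>y. indicator ?H y \<partial>distr P (Rn n) (X t))"
      unfolding J_def using H X_meas by (intro integral_distr[symmetric]) (simp_all del: One_nat_def)
    also have "\<dots> = measure (gibbs_target \<mu> n a) ?H"
      using H markov_chain_stationary[OF X gibbs_kernel_measurable_invariant[OF n]] by simp
    finally show ?thesis
      unfolding r_def p_def gibbs_target_Max_greater[OF n nonneg] .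
  qed
  have int_J: "integrable P (J t)" for t
    using J01 by (intro P.integrable_const_bound[of _ 1]) auto
  have int_avg: "integrable P avg" unfolding avg_def using int_J by simp
  have Eavg: "P.expectation avg = r / p"
    unfolding avg_def using T int_J by (simp add: EJ)
  have avg_sq: "(avg \<omega>)\<^sup>2 \<le> 1" "(avg \<omega> / r - 1 / r)\<^sup>2 \<le> (1 - avg \<omega>) / r\<^sup>2" for \<omega>
  proof -
    show "(avg \<omega>)\<^sup>2 \<le> 1" using avg01[of \<omega>] by (simp add: power_le_one)
    have "(avg \<omega> / r - 1 / r)\<^sup>2 = (1 - avg \<omega>)\<^sup>2 / r\<^sup>2"
      by (simp add: diff_divide_distrib[symmetric] power_divide power2_commute)
    \<comment> \<open>Squaring shrinks numbers in \<open>[0, 1]\<close>; this trades the second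
      moment, which involves correlations, for the known mean.\<close>
    also have "(1 - avg \<omega>)\<^sup>2 \<le> 1 - avg \<omega>"
      using avg01[of \<omega>] by (simp add: power2_eq_square mult_left_le)
    finally show "(avg \<omega> / r - 1 / r)\<^sup>2 \<le> (1 - avg \<omega>) / r\<^sup>2"
      by (simp add: divide_right_mono)
  qed
  have int_sq: "integrable P (\<lambda>\<omega>. (avg \<omega>)\<^sup>2)"
    using avg_sq by (intro P.integrable_const_bound[of _ 1]) auto
  have "P.variance (q_hat (cdf \<mu>) n a T X) = P.variance (\<lambda>\<omega>. avg \<omega> / r)"
    using q by (simp cong: Bochner_Integration.integral_cong)
  \<comment> \<open>The comparison constant \<open>1 / r\<close> is the value of the estimator when
    all indicators equal 1.\<close>
  also have "\<dots> \<le> P.expectation (\<lambda>\<omega>. (avg \<omega> / r - 1 / r)\<^sup>2)"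
    using int_avg int_sq by (intro P.variance_le_mean_square_deviation) (simp_all add: power_divide)
  also have "\<dots> \<le> P.expectation (\<lambda>\<omega>. (1 - avg \<omega>) / r\<^sup>2)"
  proof (rule integral_mono)
    show "integrable P (\<lambda>\<omega>. (avg \<omega> / r - 1 / r)\<^sup>2)"
      using int_avg int_sq by (simp add: power2_diff power_divide)
    show "integrable P (\<lambda>\<omega>. (1 - avg \<omega>) / r\<^sup>2)" using int_avg by simp
  qed (rule avg_sq)
  also have "\<dots> = (1 - r / p) / r\<^sup>2"
    using int_avg by (simp add: Eavg P.prob_space)
  finally have "p\<^sup>2 * P.variance (q_hat (cdf \<mu>) n a T X) \<le> p\<^sup>2 * ((1 - r / p) / r\<^sup>2)"
    by (intro mult_left_mono) auto
  \<comment> \<open>For \<open>p = 0\<close> both sides vanish; otherwise the factor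
    \<open>p\<close> clears the denominator.\<close>
  also have "\<dots> = (p / r)\<^sup>2 - p / r"
    using r by (cases "p = 0") (simp_all add: field_simps power2_eq_square)
  finally show ?thesis .
qed

end

section \<open>Transfer to the given random variables and passage to the limit\<close>

theorem theorem4p5:
  fixes M :: "'a measure"
    and Y :: "nat \<Rightarrow> 'a \<Rightarrow> real"
    and F\<^sub>Y f\<^sub>Y :: "real \<Rightarrow> real"
    and a :: "nat \<Rightarrow> real"
    and P :: "nat \<Rightarrow> 'b measure"
    and X :: "nat \<Rightarrow> nat \<Rightarrow> 'b \<Rightarrow> nat \<Rightarrow> real"
    and p :: "nat \<Rightarrow> real"
    and T :: nat
  assumes "prob_space M"
    and "prob_space.indep_vars M (\<lambda>_. borel) Y {1..}"
    and "\<And>i. i \<ge> 1 \<Longrightarrow> AE \<omega> in M. Y i \<omega> \<ge> 0"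
    and "\<And>i. i \<ge> 1 \<Longrightarrow> cdf (distr M borel (Y i)) = F\<^sub>Y"
    and "\<And>x. f\<^sub>Y x \<ge> 0"
    and "\<And>i. i \<ge> 1 \<Longrightarrow> distributed M lborel (Y i) (\<lambda>x. ennreal (f\<^sub>Y x))"
    and "\<And>n. n \<ge> 1 \<Longrightarrow> a n \<ge> 0"
    and "filterlim a at_top sequentially"
    and "\<And>n. n \<ge> 1 \<Longrightarrow> p n = \<P>(\<omega> in M. (\<Sum>i=1..n. Y i \<omega>) > a n)"
    and "p \<longlonglongrightarrow> 0"
    and "\<And>n. n \<ge> 1 \<Longrightarrow> \<P>(\<omega> in M. (MAX i\<in>{1..n}. Y i \<omega>) > a n) > 0"
    and "(\<lambda>n. \<P>(\<omega> in M. (\<Sum>i=1..n. Y i \<omega>) > a n)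
            / \<P>(\<omega> in M. (MAX i\<in>{1..n}. Y i \<omega>) > a n)) \<longlonglongrightarrow> 1"
    and "\<And>n. n \<ge> 1 \<Longrightarrow>
           markov_chain (P n) (Rn n) (cond_law M Y n (a n))
             (gibbs_kernel (distr M borel (Y 1)) n (a n)) (X n)"
    and "T \<ge> 1"
  shows "(\<lambda>n. (p n)\<^sup>2 * prob_space.variance (P n) (q_hat F\<^sub>Y n (a n) T (X n))) \<longlonglongrightarrow> 0"
proof -
  interpret M: prob_space M by fact
  define \<mu> where "\<mu> = distr M borel (Y 1)"
  have Y[measurable]: "i \<ge> 1 \<Longrightarrow> Y i \<in> borel_measurable M" for i
    using assms(2) by (auto simp: M.indep_vars_def)
  \<comment> \<open>A distribution function determines its law, so the common
    \<open>F\<^sub>Y\<close> makes the variables identically distributed.\<close>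
  have law: "distr M borel (Y i) = \<mu>" if "i \<ge> 1" for i
    unfolding \<mu>_def using that Y assms(4)[of i] assms(4)[of 1] by (intro cdf_unique) auto
  interpret \<mu>: real_distribution \<mu> unfolding \<mu>_def using Y by simp
  have F: "F\<^sub>Y = cdf \<mu>" using assms(4)[of 1] by (simp add: \<mu>_def)
  \<comment> \<open>Since \<open>a\<close> tends to infinity, some \<open>a m\<close> exceeds or
    equals \<open>c\<close>. If \<open>\<mu>\<close> had no mass beyond \<open>c\<close>, the
    maximum of the first \<open>m\<close> variables would almost surely be at most
    \<open>a m\<close>, contradicting its positive exceedance probability.\<close>
  have "emeasure \<mu> {c<..} > 0" for c
  proof -
    obtain m where m: "m \<ge> 1" "a m \<ge> c"
      using eventually_conj[OF eventually_ge_at_top[of 1] assms(8)[unfolded filterlim_at_top, rule_format, of c]]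
      by (auto simp: eventually_sequentially)
    show ?thesis
    proof (rule ccontr)
      assume "\<not> emeasure \<mu> {c<..} > 0"
      then have "emeasure \<mu> {c<..} = 0" by (simp add: not_gr_zero)
      then have "AE x in \<mu>. x \<notin> {c<..}"
        by (intro AE_not_in) (auto simp: null_sets_def)
      then have "AE \<omega> in M. Y i \<omega> \<le> c" if "i \<ge> 1" for i
        using Y[OF that] by (subst (asm) law[OF that, symmetric]) (simp add: AE_distr_iff not_less)
      then have "AE \<omega> in M. \<forall>i\<in>{1..m}. Y i \<omega> \<le> c"
        by (intro AE_finite_allI) auto
      then have "AE \<omega> in M. \<not> (MAX i\<in>{1..m}. Y i \<omega>) > a m"
        by eventually_elim (use m in \<open>force simp: Max_gr_iff\<close>)
      then have "\<P>(\<omega> in M. (MAX i\<in>{1..m}. Y i \<omega>) > a m) = 0"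
        by (intro M.prob_eq_0_AE)
      with assms(11)[OF m(1)] show False by simp
    qed
  qed
  then interpret \<mu>: unbounded_law \<mu> by unfold_locales
  have nonneg: "AE x in \<mu>. x \<ge> 0"
    unfolding \<mu>_def using Y[of 1] assms(3)[of 1] by (subst AE_distr_iff) auto
  define r where "r n = \<P>(\<omega> in M. (MAX i\<in>{1..n}. Y i \<omega>) > a n)" for n
  have bounds: "0 \<le> (p n)\<^sup>2 * prob_space.variance (P n) (q_hat F\<^sub>Y n (a n) T (X n)) \<and>
      (p n)\<^sup>2 * prob_space.variance (P n) (q_hat F\<^sub>Y n (a n) T (X n)) \<le> (p n / r n)\<^sup>2 - p n / r n"
    if n: "n \<ge> 1" for n
  proof -
    let ?N = "PiM {1..n} (\<lambda>_. \<mu>)" and ?V = "\<lambda>\<omega>. \<lambda>i\<in>{1..n}. Y i \<omega>"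
    let ?A = "{y \<in> space (Rn n). (\<Sum>i=1..n. y i) > a n}"
    let ?H = "{y \<in> space (Rn n). (MAX j\<in>{1..n}. y j) > a n}"
    have V[measurable]: "?V \<in> M \<rightarrow>\<^sub>M Rn n"
      by (intro measurable_restrict) auto
    have "M.indep_vars (\<lambda>_. borel) Y {1..n}"
      using assms(2) by (rule M.indep_vars_subset) auto
    \<comment> \<open>Independence identifies the joint law with the product of the
      marginals.\<close>
    then have "distr M (Rn n) ?V = (\<Pi>\<^sub>M i\<in>{1..n}. distr M borel (Y i))"
      using n Y by (subst (asm) M.indep_vars_iff_distr_eq_PiM') auto
    also have "\<dots> = ?N" using law by (intro PiM_cong) auto
    finally have V_law: "distr M (Rn n) ?V = ?N" .
    have A: "?A \<in> sets (Rn n)" and H: "?H \<in> sets (Rn n)" by measurable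
    have VA: "?V -` ?A \<inter> space M = {\<omega> \<in> space M. (\<Sum>i=1..n. Y i \<omega>) > a n}"
      using measurable_space[OF V] by auto
    have VH: "?V -` ?H \<inter> space M = {\<omega> \<in> space M. (MAX i\<in>{1..n}. Y i \<omega>) > a n}"
      using measurable_space[OF V] by auto
    have p: "p n = measure ?N ?A"
      unfolding assms(9)[OF n] VA[symmetric] V_law[symmetric] using A V by (simp add: measure_distr)
    have r: "r n = 1 - cdf \<mu> (a n) ^ n"
      unfolding r_def VH[symmetric] \<mu>.measure_Max_greater[OF n, symmetric] V_law[symmetric]
      using H V by (simp add: measure_distr)
    have "cond_law M Y n (a n) = gibbs_target \<mu> n (a n)"
      unfolding cond_law_def VA[symmetric] V_law[symmetric] using V A by (rule distr_uniform_measure_vimage)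
    then have X: "markov_chain (P n) (Rn n) (gibbs_target \<mu> n (a n)) (gibbs_kernel \<mu> n (a n)) (X n)"
      using assms(13)[OF n] by (simp add: \<mu>_def)
    show ?thesis
      unfolding p r F using \<mu>.q_hat_variance_bound[OF n assms(14) nonneg X]
      by (simp add: Bochner_Integration.integral_nonneg)
  qed
  \<comment> \<open>\<open>p n\<close> is tied to the probability only for \<open>n \<ge> 1\<close>,
    so the two ratios are known to agree only eventually.\<close>
  have lim: "(\<lambda>n. p n / r n) \<longlonglongrightarrow> 1"
    using assms(12) by (rule Lim_transform_eventually)
      (auto simp: r_def assms(9) intro: eventually_sequentiallyI[of 1])
  have "(\<lambda>n. (p n / r n)\<^sup>2 - p n / r n) \<longlonglongrightarrow> 1\<^sup>2 - 1"
    by (intro tendsto_intros lim)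
  then have lim0: "(\<lambda>n. (p n / r n)\<^sup>2 - p n / r n) \<longlonglongrightarrow> 0" by simp
  show ?thesis
    using bounds by (intro tendsto_sandwich[OF _ _ tendsto_const lim0])
      (auto intro: eventually_sequentiallyI[of 1])
qed

end
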